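(* Every uniserial commutative hemiring is a Kuratowski hemiring.
   Context: A (commutative) hemiring $(H,+,\cdot)$ is a set with $(H,+)$ a commutative monoid with identity $0$, $(H,\cdot)$ a commutative semigroup, multiplication distributing over addition, and $0h=0$ for all $h\in H$. No multiplicative identity is assumed. An ideal of $H$ is a nonempty subset $I$ with $a+b\in I$ and $ha\in I$ for all $a,b\in I$, $h\in H$. An ideal $I$ is subtractive if $x+y\in I$ and $x\in I$ imply $y\in I$, for all $x,y\in H$. $\operatorname{Id}(H)$ is the lattice of ideals of $H$ ordered by inclusion, with least element $\{0\}$ and join $I+J=\{i+j: i\in I, j\in J\}$. For $X\subseteq H$, $\operatorname{scl}_H(X)$ is the intersection of all subtractive ideals of $H$ containing $X$. A hemiring is uniserial if its ideals are linearly ordered by inclusion. A Kuratowski map on a join-semilattice $(P,\le)$ with least element $0$ is a function $k:P\to P$ such that for all $x,y\in P$: $x\le k(x)$; $k(k(x))=k(x)$; $k(0)=0$; $k(x\vee y)=k(x)\vee k(y)$. A hemiring $H$ is called a Kuratowski hemiring if $\operatorname{scl}_H$, restricted to $\operatorname{Id}(H)$, is a Kuratowski map on $\operatorname{Id}(H)$. *)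

theory Defs
  imports "HOL-Algebra.Lattice"
begin

text \<open>
  A commutative hemiring is a type of class \<^class>\<open>comm_semiring_0\<close>: a commutative additive
  monoid with a commutative, associative, distributive multiplication for which \<open>0\<close> is
  absorbing; no unit is assumed.
\<close>

definition hemiring_ideal :: "'a::comm_semiring_0 set \<Rightarrow> bool" where
  "hemiring_ideal I \<longleftrightarrow>
     I \<noteq> {} \<and> (\<forall>a\<in>I. \<forall>b\<in>I. a + b \<in> I) \<and> (\<forall>h. \<forall>a\<in>I. h * a \<in> I)"

definition subtractive_ideal :: "'a::comm_semiring_0 set \<Rightarrow> bool" where
  "subtractive_ideal I \<longleftrightarrow>
     hemiring_ideal I \<and> (\<forall>x y. x + y \<in> I \<and> x \<in> I \<longrightarrow> y \<in> I)"

definition scl :: "'a::comm_semiring_0 set \<Rightarrow> 'a set" where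
  "scl X = \<Inter> {I. subtractive_ideal I \<and> X \<subseteq> I}"

definition Id_lattice :: "'a::comm_semiring_0 itself \<Rightarrow> 'a set gorder" where
  "Id_lattice H = \<lparr>carrier = {I. hemiring_ideal I}, eq = (=), le = (\<subseteq>)\<rparr>"

definition uniserial :: "'a::comm_semiring_0 itself \<Rightarrow> bool" where
  "uniserial H \<longleftrightarrow>
     (\<forall>I J :: 'a set. hemiring_ideal I \<and> hemiring_ideal J \<longrightarrow> I \<subseteq> J \<or> J \<subseteq> I)"

locale Kuratowski_map =
  upper_semilattice P + weak_partial_order_bottom P
  for P :: "('p, 'q) gorder_scheme" (structure) +
  fixes k :: "'p \<Rightarrow> 'p"
  assumes k_closed: "k \<in> carrier P \<rightarrow> carrier P"
    and k_extensive: "x \<in> carrier P \<Longrightarrow> x \<sqsubseteq> k x"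
    and k_idem: "x \<in> carrier P \<Longrightarrow> k (k x) = k x"
    and k_bottom: "k \<bottom> = \<bottom>"
    and k_join: "\<lbrakk>x \<in> carrier P; y \<in> carrier P\<rbrakk> \<Longrightarrow> k (x \<squnion> y) = k x \<squnion> k y"

definition Kuratowski_hemiring :: "'a::comm_semiring_0 itself \<Rightarrow> bool" where
  "Kuratowski_hemiring H \<longleftrightarrow> Kuratowski_map (Id_lattice H) scl"

text \<open>
  The join and bottom in \<^locale>\<open>Kuratowski_map\<close> are the order-theoretic ones; in the
  ideal lattice they are the sum of ideals and the zero ideal.
\<close>

lemma hemiring_ideal_zero: "hemiring_ideal I \<Longrightarrow> 0 \<in> I"
  unfolding hemiring_ideal_def by (metis all_not_in_conv mult_zero_left)

lemma hemiring_ideal_sum: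
  assumes I: "hemiring_ideal I" and J: "hemiring_ideal J"
  shows "hemiring_ideal {i + j | i j. i \<in> I \<and> j \<in> J}"
  unfolding hemiring_ideal_def
proof (intro conjI ballI allI)
  show "{i + j | i j. i \<in> I \<and> j \<in> J} \<noteq> {}"
    using hemiring_ideal_zero[OF I] hemiring_ideal_zero[OF J] by blast
next
  fix a b assume "a \<in> {i + j | i j. i \<in> I \<and> j \<in> J}" "b \<in> {i + j | i j. i \<in> I \<and> j \<in> J}"
  then obtain i j i' j' where "a = i + j" "b = i' + j'" "i \<in> I" "i' \<in> I" "j \<in> J" "j' \<in> J"
    by blast
  moreover from this have "a + b = (i + i') + (j + j')" by (simp add: ac_simps)
  ultimately show "a + b \<in> {i + j | i j. i \<in> I \<and> j \<in> J}"
    using I J unfolding hemiring_ideal_def by blast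
next
  fix h a assume "a \<in> {i + j | i j. i \<in> I \<and> j \<in> J}"
  then obtain i j where "a = i + j" "i \<in> I" "j \<in> J" by blast
  moreover from this have "h * a = h * i + h * j" by (simp add: distrib_left)
  ultimately show "h * a \<in> {i + j | i j. i \<in> I \<and> j \<in> J}"
    using I J unfolding hemiring_ideal_def by blast
qed

lemma Id_lattice_least_sum:
  fixes I J :: "'a::comm_semiring_0 set"
  assumes I: "hemiring_ideal I" and J: "hemiring_ideal J"
  shows "least (Id_lattice TYPE('a)) {i + j | i j. i \<in> I \<and> j \<in> J}
           (Upper (Id_lattice TYPE('a)) {I, J})"
proof -
  let ?S = "{i + j | i j. i \<in> I \<and> j \<in> J}"
  have "I \<subseteq> ?S"
  proof
    fix i assume "i \<in> I"
    then have "i + 0 \<in> ?S" using hemiring_ideal_zero[OF J] by blast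
    then show "i \<in> ?S" by simp
  qed
  moreover have "J \<subseteq> ?S"
  proof
    fix j assume "j \<in> J"
    then have "0 + j \<in> ?S" using hemiring_ideal_zero[OF I] by blast
    then show "j \<in> ?S" by simp
  qed
  moreover have "?S \<subseteq> K" if "hemiring_ideal K" "I \<subseteq> K" "J \<subseteq> K" for K
    using that unfolding hemiring_ideal_def by blast
  ultimately show ?thesis
    using hemiring_ideal_sum[OF I J] I J
    by (auto simp: least_def Upper_def Id_lattice_def)
qed

lemma Id_lattice_least_zero:
  "least (Id_lattice TYPE('a::comm_semiring_0)) {0} (carrier (Id_lattice TYPE('a)))"
  by (auto simp: least_def Id_lattice_def hemiring_ideal_zero) (auto simp: hemiring_ideal_def)

lemma upper_semilattice_Id_lattice:
  "upper_semilattice (Id_lattice TYPE('a::comm_semiring_0))"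
proof -
  interpret partial_order "Id_lattice TYPE('a)"
    by unfold_locales (auto simp: Id_lattice_def)
  show ?thesis
    by unfold_locales (use Id_lattice_least_sum in \<open>auto simp: Id_lattice_def\<close>)
qed

lemma join_Id_lattice:
  fixes I J :: "'a::comm_semiring_0 set"
  assumes "hemiring_ideal I" "hemiring_ideal J"
  shows "I \<squnion>\<^bsub>Id_lattice TYPE('a)\<^esub> J = {i + j | i j. i \<in> I \<and> j \<in> J}"
proof -
  interpret upper_semilattice "Id_lattice TYPE('a)" by (rule upper_semilattice_Id_lattice)
  show ?thesis
    unfolding join_def sup_def using Id_lattice_least_sum[OF assms] least_unique
    by (intro some_equality) blast+
qed

lemma bottom_Id_lattice: "\<bottom>\<^bsub>Id_lattice TYPE('a::comm_semiring_0)\<^esub> = {0}"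
proof -
  interpret upper_semilattice "Id_lattice TYPE('a)" by (rule upper_semilattice_Id_lattice)
  show ?thesis
    unfolding bottom_def using Id_lattice_least_zero least_unique
    by (intro some_equality) blast+
qed

end

theory Submission
  imports Defs
begin

text \<open>Only the join axiom needs uniseriality. In any commutative hemiring, subtractive ideals
  are closed under intersection, so \<open>scl\<close> is a closure operator with ideals as values,
  and it fixes \<open>{0}\<close>, which is already subtractive. If ideals are comparable, say I
  \<subseteq> J, then I + J = J, while monotonicity gives \<open>scl I\<close> \<subseteq>
  \<open>scl J\<close>; both sides of the join axiom are then \<open>scl J\<close>. The collapse of
  the join is \<open>join_Id_lattice_absorb\<close>.\<close>

lemma subtractive_ideal_zero: "subtractive_ideal {0 :: 'a::comm_semiring_0}"
  by (auto simp: subtractive_ideal_def hemiring_ideal_def)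

lemma hemiring_ideal_Inter:
  assumes "\<And>I. I \<in> \<I> \<Longrightarrow> hemiring_ideal I"
  shows "hemiring_ideal (\<Inter>\<I>)"
proof -
  \<comment> \<open>Nonemptiness is the only condition that does not pass to intersections by
    itself; the common element 0 supplies it.\<close>
  have "0 \<in> \<Inter>\<I>"
    using assms hemiring_ideal_zero by blast
  with assms show ?thesis
    unfolding hemiring_ideal_def by blast
qed

text \<open>Both closure conditions can be checked in each ideal of the intersection. Together with
  \<open>scl_subtractive\<close> this gives idempotence.\<close>

lemma subtractive_ideal_scl: "subtractive_ideal (scl X)"
proof -
  have "hemiring_ideal (scl X)"
    unfolding scl_def by (rule hemiring_ideal_Inter) (simp add: subtractive_ideal_def)
  then show ?thesis
    unfolding subtractive_ideal_def scl_def by blast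
qed

lemma scl_extensive: "X \<subseteq> scl X"
  unfolding scl_def by blast

lemma scl_mono: "X \<subseteq> Y \<Longrightarrow> scl X \<subseteq> scl Y"
  unfolding scl_def by blast

lemma scl_subtractive: "subtractive_ideal I \<Longrightarrow> scl I = I"
  unfolding scl_def by blast

lemma hemiring_ideal_scl: "hemiring_ideal (scl X)"
  using subtractive_ideal_scl subtractive_ideal_def by blast

lemma join_Id_lattice_absorb:
  fixes I J :: "'a::comm_semiring_0 set"
  assumes I: "hemiring_ideal I" and J: "hemiring_ideal J" and "I \<subseteq> J"
  shows "I \<squnion>\<^bsub>Id_lattice TYPE('a)\<^esub> J = J" "J \<squnion>\<^bsub>Id_lattice TYPE('a)\<^esub> I = J"
proof -
  have "I \<squnion>\<^bsub>Id_lattice TYPE('a)\<^esub> J = J"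
  proof
    show "I \<squnion>\<^bsub>Id_lattice TYPE('a)\<^esub> J \<subseteq> J"
      unfolding join_Id_lattice[OF I J] using J \<open>I \<subseteq> J\<close> by (auto simp: hemiring_ideal_def)
    show "J \<subseteq> I \<squnion>\<^bsub>Id_lattice TYPE('a)\<^esub> J"
      \<comment> \<open>Each j in J is the sum 0 + j with 0 in I.\<close>
      unfolding join_Id_lattice[OF I J] using hemiring_ideal_zero[OF I] by force
  qed
  then show "I \<squnion>\<^bsub>Id_lattice TYPE('a)\<^esub> J = J" "J \<squnion>\<^bsub>Id_lattice TYPE('a)\<^esub> I = J"
    \<comment> \<open>The join is the supremum of an unordered pair, hence symmetric.\<close>
    by (simp_all add: join_def insert_commute)
qed

theorem proposition3p7:
  assumes "uniserial TYPE('a::comm_semiring_0)"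
  shows "Kuratowski_hemiring TYPE('a)"
proof -
  interpret upper_semilattice "Id_lattice TYPE('a)"
    by (rule upper_semilattice_Id_lattice)
  have "scl (I \<squnion>\<^bsub>Id_lattice TYPE('a)\<^esub> J) = scl I \<squnion>\<^bsub>Id_lattice TYPE('a)\<^esub> scl J"
    if ideals: "hemiring_ideal I" "hemiring_ideal J" for I J :: "'a set"
  proof -
    consider "I \<subseteq> J" | "J \<subseteq> I"
      using assms ideals unfolding uniserial_def by blast
    then show ?thesis
      \<comment> \<open>Absorption is applied twice: to the two ideals, and to their closures, which
        are comparable in the same direction.\<close>
      by cases (simp_all add: ideals join_Id_lattice_absorb hemiring_ideal_scl scl_mono)
  qed
  then show ?thesis
    unfolding Kuratowski_hemiring_def
    \<comment> \<open>\<open>Id_lattice_least_zero\<close> witnesses that a bottom exists. The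
      bottom equation is used with \<open>Id_lattice\<close> unfolded so that it matches goals in
      which the simplifier has unfolded the lattice.\<close>
    by unfold_locales
      (use Id_lattice_least_zero[where 'a = 'a] in
        \<open>auto simp: Id_lattice_def hemiring_ideal_scl scl_subtractive[OF subtractive_ideal_scl]
          scl_subtractive[OF subtractive_ideal_zero]
          bottom_Id_lattice[unfolded Id_lattice_def] dest: subsetD[OF scl_extensive]\<close>)
qed

end
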